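(* Assume that the initial values are $a_{-1}=0$ and $a_0\neq 0$. The inequality $$a_{-1}=0<a_0\le a_n\le a_{n+1}$$ holds for every non-negative integer $n$ if and only if $a^2-4b\ge 0$ and $$a_0>0,\qquad a\ge 1,\qquad \alpha_+\ge 1.$$
   Context: Let $a,b\in\mathbb{R}$ with $ab\neq 0$. Let $(a_n)_{n\ge -1}$ be the real sequence with the given initial values $a_{-1},a_0$ satisfying $a_{n+2}-a\,a_{n+1}+b\,a_n=0$ for all $n\ge -1$. Put $\alpha_\pm=\frac{a\pm\sqrt{a^2-4b}}{2}$, the roots of $x^2-ax+b$, where $\sqrt{a^2-4b}=\sqrt{-1}\,\sqrt{4b-a^2}$ if $a^2-4b<0$. *)

theory Defs
  imports Complex_Main "HOL-Analysis.Complex_Transcendental" "HOL-Library.Complex_Order"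
begin

text \<open>The principal root \<open>csqrt\<close> realises the convention for the square root of the discriminant:
  on a nonnegative real \<open>d\<close> it is \<open>sqrt d\<close>, on a negative one it is \<open>\<i> * sqrt (- d)\<close>.
  The order on \<open>complex\<close> is the one of \<open>Complex_Order\<close>: \<open>z \<le> w\<close> means that
  \<open>Re z \<le> Re w\<close> and \<open>Im z = Im w\<close>, so \<open>1 \<le> z\<close> says that \<open>z\<close> is real and at least 1.\<close>

definition alpha_plus :: "real \<Rightarrow> real \<Rightarrow> complex" where
  "alpha_plus a b = (of_real a + csqrt (of_real (a\<^sup>2 - 4 * b))) / 2"

end

theory Submission
  imports Defs
begin

text \<open>Write \<open>p(x) = x\<^sup>2 - a x + b\<close>. When the discriminant is nonnegative, \<open>\<alpha>\<^sub>+ \<ge> 1\<close> says that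
  \<open>p\<close> is somewhere nonpositive on \<open>[1, \<infinity>)\<close>; conversely, a nonpositive value of \<open>p\<close> there already
  forces the discriminant to be nonnegative (\<open>alpha_plus_ge_1_iff\<close>).

  For necessity, consider the quotients \<open>r\<^sub>n = u\<^sub>n\<^sub>+\<^sub>1 / u\<^sub>n\<close> of a positive nondecreasing solution.
  They are at least 1 and satisfy \<open>r\<^sub>n\<^sub>+\<^sub>1 = a - b / r\<^sub>n\<close>, that is,
  \<open>r\<^sub>n\<^sub>+\<^sub>1 - r\<^sub>n = - p(r\<^sub>n) / r\<^sub>n\<close>. If \<open>p\<close> were positive on \<open>[1, \<infinity>)\<close>, they would decrease to a limit
  that is at least 1 and is a zero of \<open>p\<close>, a contradiction
  (\<open>exists_nonpos_value_of_char_poly\<close>). The bound \<open>a \<ge> 1\<close> is just \<open>u\<^sub>1 = a u\<^sub>0 \<ge> u\<^sub>0\<close>.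

  For sufficiency, the sign of \<open>b = \<alpha>\<^sub>+ \<alpha>\<^sub>-\<close> matters. If \<open>b < 0\<close>, the recurrence
  \<open>u\<^sub>n\<^sub>+\<^sub>2 = a u\<^sub>n\<^sub>+\<^sub>1 + \<bar>b\<bar> u\<^sub>n\<close> with \<open>a \<ge> 1\<close> visibly preserves positivity and growth. If \<open>b > 0\<close>,
  then \<open>\<alpha>\<^sub>- > 0\<close>, and \<open>u\<^sub>n\<^sub>+\<^sub>1 = \<alpha>\<^sub>+ u\<^sub>n + \<alpha>\<^sub>-\<^sup>n\<^sup>+\<^sup>1 u\<^sub>0\<close> (\<open>recurrence_peel_root\<close>) gives
  growth because \<open>\<alpha>\<^sub>+ \<ge> 1\<close>. Unlike the Binet formula, this identity divides by no difference of
  roots, so a double root is not a special case.\<close>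

lemma alpha_plus_ge_1_iff_real:
  fixes a b :: real
  assumes "a\<^sup>2 - 4 * b \<ge> 0"
  shows "alpha_plus a b \<ge> 1 \<longleftrightarrow> (a + sqrt (a\<^sup>2 - 4 * b)) / 2 \<ge> 1"
proof -
  have "csqrt (of_real (a\<^sup>2 - 4 * b)) = of_real (sqrt (a\<^sup>2 - 4 * b))"
    using assms by (rule of_real_sqrt[symmetric])
  then have "alpha_plus a b = of_real ((a + sqrt (a\<^sup>2 - 4 * b)) / 2)"
    by (simp add: alpha_plus_def)
  then show ?thesis
    by (simp only: less_eq_complex_def Re_complex_of_real Im_complex_of_real one_complex.sel) simp
qed

text \<open>Complete the square: \<open>p(x) \<le> 0\<close> is \<open>(2 x - a)\<^sup>2 \<le> a\<^sup>2 - 4 b\<close>.\<close>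

lemma alpha_plus_ge_1_iff:
  "a\<^sup>2 - 4 * b \<ge> 0 \<and> alpha_plus a b \<ge> 1 \<longleftrightarrow> (\<exists>x\<ge>1. x\<^sup>2 - a * x + b \<le> 0)"
proof
  assume h: "a\<^sup>2 - 4 * b \<ge> 0 \<and> alpha_plus a b \<ge> 1"
  define s where "s = sqrt (a\<^sup>2 - 4 * b)"
  have "s\<^sup>2 = a\<^sup>2 - 4 * b"
    using h by (simp add: s_def)
  then have "((a + s) / 2)\<^sup>2 - a * ((a + s) / 2) + b = 0"
    by (simp add: power2_eq_square field_simps)
  moreover have "(a + s) / 2 \<ge> 1"
    using h alpha_plus_ge_1_iff_real[of a b] by (simp add: s_def)
  ultimately show "\<exists>x\<ge>1. x\<^sup>2 - a * x + b \<le> 0"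
    by (intro exI[of _ "(a + s) / 2"]) simp
next
  assume "\<exists>x\<ge>1. x\<^sup>2 - a * x + b \<le> 0"
  then obtain x where x: "x \<ge> 1" "x\<^sup>2 - a * x + b \<le> 0"
    by blast
  have sq: "(2 * x - a)\<^sup>2 \<le> a\<^sup>2 - 4 * b"
    using x(2) by (simp add: power2_eq_square algebra_simps)
  then have d: "a\<^sup>2 - 4 * b \<ge> 0"
    by (meson order_trans zero_le_power2)
  have "2 * x - a \<le> sqrt (a\<^sup>2 - 4 * b)"
    using sq by (rule real_le_rsqrt)
  with d x(1) show "a\<^sup>2 - 4 * b \<ge> 0 \<and> alpha_plus a b \<ge> 1"
    by (simp add: alpha_plus_ge_1_iff_real)
qed

text \<open>Otherwise the quotients of consecutive terms would decrease to a zero of the polynomial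
  in \<open>[1, \<infinity>)\<close>. Asking for a nonpositive value rather than a zero makes the negation say that the
  polynomial is positive there, which is the monotonicity of the quotients.\<close>

lemma exists_nonpos_value_of_char_poly:
  fixes a b :: real and v :: "nat \<Rightarrow> real"
  assumes rec: "\<And>n. v (Suc (Suc n)) = a * v (Suc n) - b * v n"
    and pos: "\<And>n. v n > 0"
    and mono: "\<And>n. v n \<le> v (Suc n)"
  shows "\<exists>x\<ge>1. x\<^sup>2 - a * x + b \<le> 0"
proof (rule ccontr)
  assume "\<not> (\<exists>x\<ge>1. x\<^sup>2 - a * x + b \<le> 0)"
  then have p_pos: "x\<^sup>2 - a * x + b > 0" if "x \<ge> 1" for x
    using that by force
  define r where "r n = v (Suc n) / v n" for n
  have r_ge: "r n \<ge> 1" for n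
    using pos[of n] mono[of n] by (simp add: r_def)
  \<comment> \<open>Stated without division, so that it passes to the limit by continuity alone.\<close>
  have r_rec: "r (Suc n) * r n = a * r n - b" for n
    using pos[of n] pos[of "Suc n"] by (simp add: r_def rec field_simps)
  have "decseq r"
  proof (rule decseq_SucI)
    fix n
    have "r (Suc n) * r n \<le> r n * r n"
      using p_pos[OF r_ge[of n]] r_rec[of n] by (simp add: power2_eq_square)
    then show "r (Suc n) \<le> r n"
      using r_ge[of n] by (simp add: mult_le_cancel_right)
  qed
  then obtain l where l: "r \<longlonglongrightarrow> l"
    using decseq_convergent[of r 1] r_ge by blast
  have l_ge: "l \<ge> 1"
    using l r_ge by (intro LIMSEQ_le_const) auto
  have "(\<lambda>n. r (Suc n) * r n) \<longlonglongrightarrow> l * l"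
    by (intro tendsto_mult LIMSEQ_Suc l)
  moreover have "(\<lambda>n. r (Suc n) * r n) \<longlonglongrightarrow> a * l - b"
    unfolding r_rec by (intro tendsto_intros l)
  ultimately have "l * l = a * l - b"
    by (rule LIMSEQ_unique)
  with p_pos[OF l_ge] show False
    by (simp add: power2_eq_square)
qed

text \<open>The shift operator satisfies \<open>(E - \<alpha>) (E - \<beta>) v = 0\<close>, so \<open>(E - \<alpha>) v\<close> is geometric with
  ratio \<open>\<beta>\<close>. Its first term is \<open>\<beta> v\<^sub>0\<close> because a vanishing term precedes \<open>v\<^sub>0\<close>, which is what
  the condition on \<open>v\<^sub>1\<close> encodes.\<close>

lemma recurrence_peel_root:
  fixes \<alpha> \<beta> :: "'a :: comm_ring_1"
  assumes rec: "\<And>n. v (Suc (Suc n)) = (\<alpha> + \<beta>) * v (Suc n) - \<alpha> * \<beta> * v n"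
    and v1: "v (Suc 0) = (\<alpha> + \<beta>) * v 0"
  shows "v (Suc n) = \<alpha> * v n + \<beta> ^ Suc n * v 0"
proof (induction n)
  case 0
  show ?case by (simp add: v1 algebra_simps)
next
  case (Suc n)
  have "v (Suc (Suc n)) = \<alpha> * v (Suc n) + \<beta> * (v (Suc n) - \<alpha> * v n)"
    by (simp add: rec algebra_simps)
  also have "v (Suc n) - \<alpha> * v n = \<beta> ^ Suc n * v 0"
    using Suc.IH by simp
  finally show ?case by (simp add: mult.assoc)
qed

lemma nondecreasing_solution:
  fixes a b :: real and v :: "nat \<Rightarrow> real"
  assumes rec: "\<And>n. v (Suc (Suc n)) = a * v (Suc n) - b * v n"
    and v1: "v (Suc 0) = a * v 0"
    and v0: "v 0 > 0"
    and a: "a \<ge> 1"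
    and d: "a\<^sup>2 - 4 * b \<ge> 0"
    and root: "(a + sqrt (a\<^sup>2 - 4 * b)) / 2 \<ge> 1"
  shows "v n > 0 \<and> v n \<le> v (Suc n)"
proof (cases "b \<le> 0")
  case True
  show ?thesis
  proof (induction n)
    case 0
    show ?case using v0 a by (simp add: v1)
  next
    case (Suc n)
    have "v (Suc n) > 0"
      using Suc.IH by linarith
    then have "v (Suc n) \<le> a * v (Suc n)"
      using a by simp
    moreover have "b * v n \<le> 0"
      using Suc.IH True by (simp add: mult_nonpos_nonneg)
    ultimately show ?case
      using \<open>v (Suc n) > 0\<close> rec[of n] by linarith
  qed
next
  case False
  define s where "s = sqrt (a\<^sup>2 - 4 * b)"
  define \<alpha> where "\<alpha> = (a + s) / 2"
  define \<beta> where "\<beta> = (a - s) / 2"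
  have "s\<^sup>2 = a\<^sup>2 - 4 * b"
    using d by (simp add: s_def)
  then have vieta: "\<alpha> + \<beta> = a" "\<alpha> * \<beta> = b"
    by (simp_all add: \<alpha>_def \<beta>_def power2_eq_square field_simps)
  have \<alpha>: "\<alpha> \<ge> 1"
    using root by (simp add: \<alpha>_def s_def)
  have "\<beta> > 0"
    using False vieta(2) \<alpha> by (auto simp: zero_less_mult_iff not_le)
  have step: "v (Suc m) = \<alpha> * v m + \<beta> ^ Suc m * v 0" for m
    by (rule recurrence_peel_root) (simp_all add: vieta rec v1)
  have growth: "v m \<le> v (Suc m)" if "v m > 0" for m
  proof -
    have "v m \<le> \<alpha> * v m"
      using that \<alpha> by simp
    moreover have "\<beta> ^ Suc m * v 0 > 0"
      using \<open>\<beta> > 0\<close> v0 by simp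
    ultimately show ?thesis
      using step[of m] by linarith
  qed
  have "v n > 0"
  proof (induction n)
    case 0
    show ?case by (rule v0)
  next
    case (Suc n)
    then show ?case using growth[of n] by linarith
  qed
  with growth show ?thesis by blast
qed

theorem corollary1p6:
  fixes a b :: real and u :: "int \<Rightarrow> real"
  assumes "a * b \<noteq> 0"
    and "\<And>n. n \<ge> -1 \<Longrightarrow> u (n + 2) - a * u (n + 1) + b * u n = 0"
    and "u (-1) = 0"
    and "u 0 \<noteq> 0"
  shows "(\<forall>n\<ge>0. u (-1) = 0 \<and> 0 < u 0 \<and> u 0 \<le> u n \<and> u n \<le> u (n + 1)) \<longleftrightarrow>
    (a\<^sup>2 - 4 * b \<ge> 0 \<and> u 0 > 0 \<and> a \<ge> 1 \<and> alpha_plus a b \<ge> 1)"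
proof -
  define v where "v n = u (int n)" for n
  have v_Suc: "v (Suc n) = u (int n + 1)" for n
    by (simp add: v_def add.commute)
  have rec: "v (Suc (Suc n)) = a * v (Suc n) - b * v n" for n
    using assms(2)[of "int n"] by (simp add: v_def algebra_simps)
  have v1: "v (Suc 0) = a * v 0"
    using assms(2)[of "-1"] assms(3) by (simp add: v_def)
  show ?thesis
  proof
    assume L: "\<forall>n\<ge>0. u (-1) = 0 \<and> 0 < u 0 \<and> u 0 \<le> u n \<and> u n \<le> u (n + 1)"
    then have u0: "u 0 > 0"
      by blast
    have mono: "v n \<le> v (Suc n)" for n
      using L by (simp add: v_Suc) (simp add: v_def)
    have pos: "v n > 0" for n
    proof -
      have "u 0 \<le> v n"
        using L by (simp add: v_def)
      with u0 show ?thesis by linarith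
    qed
    have "a \<ge> 1"
      using mono[of 0] pos[of 0] by (simp add: v1)
    moreover have "a\<^sup>2 - 4 * b \<ge> 0 \<and> alpha_plus a b \<ge> 1"
      unfolding alpha_plus_ge_1_iff
      by (rule exists_nonpos_value_of_char_poly) (fact rec pos mono)+
    ultimately show "a\<^sup>2 - 4 * b \<ge> 0 \<and> u 0 > 0 \<and> a \<ge> 1 \<and> alpha_plus a b \<ge> 1"
      using u0 by blast
  next
    assume R: "a\<^sup>2 - 4 * b \<ge> 0 \<and> u 0 > 0 \<and> a \<ge> 1 \<and> alpha_plus a b \<ge> 1"
    then have root: "(a + sqrt (a\<^sup>2 - 4 * b)) / 2 \<ge> 1"
      using alpha_plus_ge_1_iff_real by blast
    have "v 0 > 0"
      using R by (simp add: v_def)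
    then have mono: "v n \<le> v (Suc n)" for n
      using nondecreasing_solution[of v a b n] rec v1 R root by blast
    show "\<forall>n\<ge>0. u (-1) = 0 \<and> 0 < u 0 \<and> u 0 \<le> u n \<and> u n \<le> u (n + 1)"
    proof (intro allI impI)
      fix n :: int
      assume "n \<ge> 0"
      then obtain k where k: "n = int k"
        using nonneg_int_cases by blast
      have "v 0 \<le> v k"
        using mono by (rule lift_Suc_mono_le[of v]) simp
      then have "u 0 \<le> u n"
        by (simp add: v_def k)
      moreover have "u n \<le> u (n + 1)"
        using mono[of k] by (simp add: v_Suc k) (simp add: v_def)
      ultimately show "u (-1) = 0 \<and> 0 < u 0 \<and> u 0 \<le> u n \<and> u n \<le> u (n + 1)"
        using R assms(3) by blast
    qed
  qed
qed

end
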